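(* Let $G$ be a connected bipartite graph with bipartition $(A,B)$, and let $\overline{G}$ be its complement. Then $\mathrm{mp}(\overline{G}) = \max\{\alpha(G), \psi(G)\}$.
   Context: All graphs are finite, simple and undirected. A path $P$ in a graph is monophonic (induced) if the graph contains no edge between vertices that are non-consecutive on $P$. A set $M$ of vertices is a monophonic position set (mp-set) if no three vertices of $M$ lie on a common monophonic path; $\mathrm{mp}$ of a graph is the number of vertices in a largest mp-set. $\alpha(G)$ is the independence number of $G$ and $N(u)$ is the set of neighbours of $u$ in $G$. For a connected bipartite graph $G$ with bipartition $(A,B)$, a set $X$ contained in $A$ or in $B$ is uniform in $G$ if $N(u) = N(v)$ for all $u,v \in X$; a set $S \subseteq V(G)$ is a uniform set if both $S_A = S \cap A$ and $S_B = S \cap B$ are uniform in $G$. $\psi(G)$ is the number of vertices in a largest uniform set in $G$. *)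

theory Defs
  imports "Graph_Theory.Graph_Theory"
begin

text \<open>
  Finite simple undirected graphs are the instances of \<^locale>\<open>pair_graph\<close>: finite vertex set,
  loop-free, and each edge present as both of its orientations.
\<close>

definition complement_graph :: "'a pair_pre_digraph \<Rightarrow> 'a pair_pre_digraph" where
  "complement_graph G =
    \<lparr> pverts = pverts G,
      parcs = {(u, v). u \<in> pverts G \<and> v \<in> pverts G \<and> u \<noteq> v \<and> (u, v) \<notin> parcs G} \<rparr>"

lemma pair_graph_complement_graph:
  assumes "pair_graph G"
  shows "pair_graph (complement_graph G)"
proof -
  interpret pair_graph G by fact
  have "parcs (complement_graph G) \<subseteq> pverts G \<times> pverts G"
    by (auto simp: complement_graph_def)
  then have "finite (parcs (complement_graph G))"
    using pair_finite_verts finite_subset by blast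
  moreover have "(v, u) \<in> parcs G" if "(u, v) \<in> parcs G" for u v
    using that by (rule arcs_symmetric)
  ultimately show ?thesis
    by unfold_locales (auto simp: complement_graph_def symmetric_def intro!: symI)
qed

definition neighbours :: "'a pair_pre_digraph \<Rightarrow> 'a \<Rightarrow> 'a set" where
  "neighbours G u = {v. (u, v) \<in> parcs G}"

definition bipartition :: "'a pair_pre_digraph \<Rightarrow> 'a set \<Rightarrow> 'a set \<Rightarrow> bool" where
  "bipartition G A B \<longleftrightarrow>
    A \<union> B = pverts G \<and> A \<inter> B = {} \<and> parcs G \<subseteq> A \<times> B \<union> B \<times> A"

definition independent_set :: "'a pair_pre_digraph \<Rightarrow> 'a set \<Rightarrow> bool" where
  "independent_set G S \<longleftrightarrow> S \<subseteq> pverts G \<and> (\<forall>u\<in>S. \<forall>v\<in>S. (u, v) \<notin> parcs G)"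

definition independence_number :: "'a pair_pre_digraph \<Rightarrow> nat" where
  "independence_number G = Max {card S | S. independent_set G S}"

text \<open>Paths are nonempty lists of distinct vertices; a single vertex is a path.\<close>

definition monophonic_path :: "'a pair_pre_digraph \<Rightarrow> 'a list \<Rightarrow> bool" where
  "monophonic_path G p \<longleftrightarrow> vpath p (with_proj G) \<and>
    (\<forall>i j. i < length p \<and> j < length p \<and> (p ! i, p ! j) \<in> parcs G \<longrightarrow> i = Suc j \<or> j = Suc i)"

definition mp_set :: "'a pair_pre_digraph \<Rightarrow> 'a set \<Rightarrow> bool" where
  "mp_set G M \<longleftrightarrow> M \<subseteq> pverts G \<and>
    \<not> (\<exists>x\<in>M. \<exists>y\<in>M. \<exists>z\<in>M. x \<noteq> y \<and> y \<noteq> z \<and> x \<noteq> z \<and>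
          (\<exists>p. monophonic_path G p \<and> {x, y, z} \<subseteq> set p))"

definition mp_number :: "'a pair_pre_digraph \<Rightarrow> nat" where
  "mp_number G = Max {card M | M. mp_set G M}"

definition uniform :: "'a pair_pre_digraph \<Rightarrow> 'a set \<Rightarrow> bool" where
  "uniform G X \<longleftrightarrow> (\<forall>u\<in>X. \<forall>v\<in>X. neighbours G u = neighbours G v)"

definition uniform_set :: "'a pair_pre_digraph \<Rightarrow> 'a set \<Rightarrow> 'a set \<Rightarrow> 'a set \<Rightarrow> bool" where
  "uniform_set G A B S \<longleftrightarrow>
    S \<subseteq> pverts G \<and> uniform G (S \<inter> A) \<and> uniform G (S \<inter> B)"

definition uniform_number :: "'a pair_pre_digraph \<Rightarrow> 'a set \<Rightarrow> 'a set \<Rightarrow> nat" where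
  "uniform_number G A B = Max {card S | S. uniform_set G A B S}"

end

theory Submission
  imports Defs
begin

text \<open>
  In the complement of \<open>G\<close> both parts are cliques. An independent set of \<open>G\<close> is a clique of the
  complement, and two vertices of one part with equal neighbourhoods are adjacent twins there; an
  induced path contains no triangle, and no adjacent twins once it has a third vertex.
  Conversely, let \<open>x\<close>, \<open>y\<close> be vertices of an mp-set in one part with \<open>w\<close> a neighbour of \<open>x\<close> but
  not of \<open>y\<close>. A vertex \<open>z\<close> of the mp-set in the other part lies on the induced path \<open>x y z\<close> or \<open>y x z\<close>
  of the complement if it has one neighbour among \<open>x\<close>, \<open>y\<close> in \<open>G\<close>, and on \<open>x y w z\<close> if it has both.
  So it has none, and this excludes every edge inside the mp-set, since one of \<open>x\<close>, \<open>y\<close> differs in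
  neighbourhood from any given vertex of the same part: the mp-sets of the complement are exactly the
  independent sets and the uniform sets of \<open>G\<close>.
\<close>

section \<open>Adjacency along induced paths in terms of positions\<close>

lemma vwalk_arcs_nth_Suc: "Suc i < length p \<Longrightarrow> (p ! i, p ! Suc i) \<in> set (vwalk_arcs p)"
proof (induction p arbitrary: i rule: vwalk_arcs.induct)
  case (3 x y p)
  then show ?case by (cases i) auto
qed auto

text \<open>The walk condition makes consecutive vertices adjacent, symmetry adds the reverse arcs,
  and monophony excludes all others. Adjacency on the path thus becomes arithmetic on
  positions.\<close>

lemma monophonic_path_nth_adj:
  assumes "symmetric (with_proj H)" "monophonic_path H p" "i < length p" "j < length p"
  shows "(p ! i, p ! j) \<in> parcs H \<longleftrightarrow> i = Suc j \<or> j = Suc i"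
proof -
  have "(p ! k, p ! Suc k) \<in> parcs H \<and> (p ! Suc k, p ! k) \<in> parcs H" if "Suc k < length p" for k
  proof -
    have "(p ! k, p ! Suc k) \<in> parcs H"
      using assms(2) vwalk_arcs_nth_Suc[OF that]
      by (auto simp: monophonic_path_def vpath_def vwalk_def)
    then show ?thesis
      using assms(1) by (auto simp: symmetric_def dest: symD)
  qed
  with assms show ?thesis
    unfolding monophonic_path_def by blast
qed

text \<open>Positions of adjacent vertices have opposite parity, which is impossible for three
  positions pairwise.\<close>

lemma monophonic_path_no_triangle:
  assumes "symmetric (with_proj H)" "monophonic_path H p" "{x, y, z} \<subseteq> set p"
    and "(x, y) \<in> parcs H" "(y, z) \<in> parcs H" "(x, z) \<in> parcs H"
  shows False
proof -
  obtain i j k where "i < length p" "j < length p" "k < length p" "x = p ! i" "y = p ! j" "z = p ! k"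
    using assms(3) by (auto simp: in_set_conv_nth)
  with assms(4-6) monophonic_path_nth_adj[OF assms(1,2)]
  have "i = Suc j \<or> j = Suc i" "j = Suc k \<or> k = Suc j" "i = Suc k \<or> k = Suc i"
    by blast+
  then show False by arith
qed

text \<open>A further vertex next to one of two consecutive vertices is at distance two from the
  other and so tells the twins apart. Hence the path cannot continue beyond the pair at either
  end.\<close>

lemma monophonic_path_adjacent_twins:
  assumes "symmetric (with_proj H)" "monophonic_path H p" "{x, y} \<subseteq> set p" "(x, y) \<in> parcs H"
    and twins: "\<And>w. w \<in> set p - {x, y} \<Longrightarrow> (x, w) \<in> parcs H \<longleftrightarrow> (y, w) \<in> parcs H"
  shows "set p = {x, y}"
proof -
  note adj = monophonic_path_nth_adj[OF assms(1,2)]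
  have "distinct p"
    using assms(2) by (simp add: monophonic_path_def vpath_def)
  obtain i j where ij: "i < length p" "j < length p" "x = p ! i" "y = p ! j"
    using assms(3) by (auto simp: in_set_conv_nth)
  have consecutive: "i = Suc j \<or> j = Suc i"
    using adj ij assms(4) by blast
  have twins_nth: "(i = Suc k \<or> k = Suc i) \<longleftrightarrow> (j = Suc k \<or> k = Suc j)"
    if "k < length p" "k \<noteq> i" "k \<noteq> j" for k
    using twins[of "p ! k"] that ij adj \<open>distinct p\<close> by (simp add: nth_eq_iff_index_eq)
  have "k = i \<or> k = j" if "k < length p" for k
    using consecutive
  proof
    assume i: "i = Suc j"
    have "\<not> Suc i < length p"
      using twins_nth[of "Suc i"] i by auto
    \<comment> \<open>For \<open>j > 0\<close> the position \<open>j - 1\<close> is next to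
      \<open>j\<close> but not next to \<open>i = Suc j\<close>.\<close>
    moreover have "j = 0"
      using twins_nth[of "j - 1"] i ij(1) by (cases j) auto
    ultimately show ?thesis
      using i that by linarith
  next
    assume j: "j = Suc i"
    have "\<not> Suc j < length p"
      using twins_nth[of "Suc j"] j by auto
    moreover have "i = 0"
      using twins_nth[of "i - 1"] j ij(2) by (cases i) auto
    ultimately show ?thesis
      using j that by linarith
  qed
  then have "set p \<subseteq> {x, y}"
    using ij(3,4) unfolding in_set_conv_nth subset_iff by blast
  then show ?thesis
    using assms(3) by auto
qed

section \<open>Explicit induced paths that refute the mp-set property\<close>

lemma mp_setD:
  assumes "mp_set H M" "x \<in> M" "y \<in> M" "z \<in> M" "distinct [x, y, z]"
    and "monophonic_path H p" "{x, y, z} \<subseteq> set p"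
  shows False
proof -
  have "x \<noteq> y" "y \<noteq> z" "x \<noteq> z"
    using assms(5) by auto
  with assms(1-4,6,7) show False
    unfolding mp_set_def by blast
qed

lemma monophonic_path_3I:
  assumes "symmetric (with_proj H)" "{x, y, z} \<subseteq> pverts H" "distinct [x, y, z]"
    and "(x, y) \<in> parcs H" "(y, z) \<in> parcs H" "(x, z) \<notin> parcs H"
    and "\<And>v. (v, v) \<notin> parcs H"
  shows "monophonic_path H [x, y, z]"
proof -
  have sym: "(u, v) \<in> parcs H \<longleftrightarrow> (v, u) \<in> parcs H" for u v
    using assms(1) by (auto simp: symmetric_def dest: symD)
  \<comment> \<open>Monophony splits into one case for each ordered pair of positions; the instances
    of \<open>sym\<close> settle the reversed pairs.\<close>
  show ?thesis
    using assms(2-) sym[of x y] sym[of y z] sym[of x z]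
    by (simp add: monophonic_path_def vpath_def vwalk_def less_Suc_eq nth_Cons' all_conj_distrib
        conj_disj_distribR)
qed

lemma monophonic_path_4I:
  assumes "symmetric (with_proj H)" "{x, y, w, z} \<subseteq> pverts H" "distinct [x, y, w, z]"
    and "(x, y) \<in> parcs H" "(y, w) \<in> parcs H" "(w, z) \<in> parcs H"
    and "(x, w) \<notin> parcs H" "(x, z) \<notin> parcs H" "(y, z) \<notin> parcs H"
    and "\<And>v. (v, v) \<notin> parcs H"
  shows "monophonic_path H [x, y, w, z]"
proof -
  have sym: "(u, v) \<in> parcs H \<longleftrightarrow> (v, u) \<in> parcs H" for u v
    using assms(1) by (auto simp: symmetric_def dest: symD)
  show ?thesis
    using assms(2-) sym[of x y] sym[of x w] sym[of x z] sym[of y w] sym[of y z] sym[of w z]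
    by (simp add: monophonic_path_def vpath_def vwalk_def less_Suc_eq nth_Cons' all_conj_distrib
        conj_disj_distribR)
qed

section \<open>Bipartite graphs and their complements\<close>

lemma bipartition_commute: "bipartition G A B \<longleftrightarrow> bipartition G B A"
  by (auto simp: bipartition_def)

locale bipartite_graph =
  fixes G :: "'a pair_pre_digraph" and A B :: "'a set"
  assumes pair_graph: "pair_graph G" and bipartition: "bipartition G A B"
begin

abbreviation "H \<equiv> complement_graph G"

text \<open>Carries each fact proved about \<open>A\<close> over to \<open>B\<close>.\<close>

lemma swap_parts: "bipartite_graph G B A"
  using pair_graph bipartition by (simp add: bipartite_graph_def bipartition_commute)

lemma symmetric_complement: "symmetric (with_proj H)"
proof -
  interpret H: pair_graph H
    by (rule pair_graph_complement_graph[OF pair_graph])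
  show ?thesis by (rule H.sym_arcs)
qed

lemma arcs_symmetric: "(u, v) \<in> parcs G \<Longrightarrow> (v, u) \<in> parcs G"
proof -
  interpret pair_graph G by (rule pair_graph)
  show "(u, v) \<in> parcs G \<Longrightarrow> (v, u) \<in> parcs G" by (rule arcs_symmetric)
qed

lemma complement_loopfree: "(v, v) \<notin> parcs H"
  by (simp add: complement_graph_def)

lemma complement_verts: "pverts H = pverts G"
  by (simp add: complement_graph_def)

lemma part_arcs: "u \<in> A \<Longrightarrow> (u, v) \<in> parcs G \<Longrightarrow> v \<in> B" "u \<in> A \<Longrightarrow> v \<in> A \<Longrightarrow> (u, v) \<notin> parcs G"
  using bipartition by (auto simp: bipartition_def)

lemma part_verts: "A \<subseteq> pverts G" "B \<subseteq> pverts G" "A \<inter> B = {}" "A \<union> B = pverts G"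
  using bipartition by (auto simp: bipartition_def)

section \<open>Independent sets and uniform sets are mp-sets of the complement\<close>

lemma independent_set_imp_mp_set:
  assumes "independent_set G M"
  shows "mp_set H M"
proof -
  have "M \<subseteq> pverts G"
    using assms by (simp add: independent_set_def)
  moreover have "(x, y) \<in> parcs H" if "x \<in> M" "y \<in> M" "x \<noteq> y" for x y
    using assms that by (auto simp: independent_set_def complement_graph_def)
  ultimately show ?thesis
    using monophonic_path_no_triangle[OF symmetric_complement]
    unfolding mp_set_def complement_verts by (meson insert_subset)
qed

lemma uniform_twins_not_on_longer_path:
  assumes "uniform G (M \<inter> A)" "x \<in> M \<inter> A" "y \<in> M \<inter> A" "x \<noteq> y"
    and "monophonic_path H p" "{x, y} \<subseteq> set p"
  shows "set p = {x, y}"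
proof (rule monophonic_path_adjacent_twins[OF symmetric_complement assms(5,6)])
  show "(x, y) \<in> parcs H"
    using assms part_arcs(2) part_verts by (auto simp: complement_graph_def)
  have "neighbours G x = neighbours G y"
    using assms(1-3) unfolding uniform_def by blast
  then show "(x, w) \<in> parcs H \<longleftrightarrow> (y, w) \<in> parcs H" if "w \<in> set p - {x, y}" for w
    using that assms(2,3) part_verts by (auto simp: complement_graph_def neighbours_def)
qed

lemma uniform_set_imp_mp_set:
  assumes "uniform_set G A B M"
  shows "mp_set H M"
proof -
  have M: "M \<subseteq> A \<union> B" "uniform G (M \<inter> A)" "uniform G (M \<inter> B)"
    using assms part_verts(4) by (simp_all add: uniform_set_def)
  have False if xyz: "x \<in> M" "y \<in> M" "z \<in> M" "x \<noteq> y" "y \<noteq> z" "x \<noteq> z"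
    and p: "monophonic_path H p" "{x, y, z} \<subseteq> set p" for x y z p
  proof -
    \<comment> \<open>Twins in one part would be the only vertices of \<open>p\<close>, but
      \<open>p\<close> has at least three. By pigeonhole, two of \<open>x\<close>, \<open>y\<close>,
      \<open>z\<close> share a part.\<close>
    have "\<not> (u \<in> A \<and> v \<in> A)" "\<not> (u \<in> B \<and> v \<in> B)"
      if uv: "u \<in> M" "v \<in> M" "u \<noteq> v" "{u, v} \<subseteq> set p" and "card (set p) > 2" for u v
    proof -
      have "set p \<noteq> {u, v}"
        using that by auto
      then show "\<not> (u \<in> A \<and> v \<in> A)" "\<not> (u \<in> B \<and> v \<in> B)"
        using uniform_twins_not_on_longer_path[OF M(2) _ _ uv(3) p(1) uv(4)]
          bipartite_graph.uniform_twins_not_on_longer_path[OF swap_parts M(3) _ _ uv(3) p(1) uv(4)] uv(1,2) by auto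
    qed
    moreover have "card (set p) > 2"
      using xyz(4-6) card_mono[OF _ p(2)] by simp
    moreover have "{x, y} \<subseteq> set p" "{y, z} \<subseteq> set p" "{x, z} \<subseteq> set p"
      using p(2) by auto
    moreover have "x \<in> A \<or> x \<in> B" "y \<in> A \<or> y \<in> B" "z \<in> A \<or> z \<in> B"
      using xyz(1-3) M(1) by auto
    ultimately show False
      using xyz by metis
  qed
  moreover have "M \<subseteq> pverts H"
    using assms by (simp add: uniform_set_def complement_graph_def)
  ultimately show ?thesis
    unfolding mp_set_def by blast
qed

section \<open>Every mp-set of the complement is independent or uniform\<close>

lemma mp_set_no_common_edge:
  assumes M: "mp_set H M" and x: "x \<in> M \<inter> A" and y: "y \<in> M \<inter> A" and z: "z \<in> M \<inter> B"
    and ne: "neighbours G x \<noteq> neighbours G y"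
  shows "(x, z) \<notin> parcs G"
proof
  assume xz: "(x, z) \<in> parcs G"
  have H_iff: "(u, v) \<in> parcs H \<longleftrightarrow> (u, v) \<notin> parcs G \<and> u \<noteq> v"
    if "u \<in> pverts G" "v \<in> pverts G" for u v
    using that by (auto simp: complement_graph_def)
  have verts: "x \<in> pverts G" "y \<in> pverts G" "z \<in> pverts G"
    using x y z part_verts by auto
  have dist: "x \<noteq> y" "x \<noteq> z" "y \<noteq> z"
    using x y z part_verts ne by auto
  have xy: "(x, y) \<notin> parcs G" "(y, x) \<notin> parcs G"
    using x y part_arcs by auto
  \<comment> \<open>Stated for \<open>u\<close>, \<open>v\<close> because the vertex
    \<open>w\<close> separating the neighbourhoods may be adjacent to \<open>x\<close> or to
    \<open>y\<close>. It need not belong to \<open>M\<close>: only \<open>u\<close>,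
    \<open>v\<close>, \<open>z\<close> enter the contradiction. It differs from \<open>z\<close>
    since \<open>v\<close> is adjacent in \<open>G\<close> to \<open>z\<close> but not to
    \<open>w\<close>.\<close>
  have path4: False if uv: "u \<in> M \<inter> A" "v \<in> M \<inter> A" and w: "(u, w) \<in> parcs G" "(v, w) \<notin> parcs G"
    and uz: "(u, z) \<in> parcs G" and vz: "(v, z) \<in> parcs G" for u v w
  proof (rule mp_setD[OF M])
    have "w \<in> B"
      using uv w part_arcs by blast
    then have wz: "(w, z) \<notin> parcs G" "w \<in> pverts G" "w \<noteq> z"
      using z bipartite_graph.part_arcs[OF swap_parts] part_verts w vz by auto
    show "monophonic_path H [u, v, w, z]"
      using uv w uz vz wz z \<open>w \<in> B\<close> part_verts part_arcs(2)
      by (intro monophonic_path_4I symmetric_complement complement_loopfree)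
        (auto simp: H_iff complement_verts subset_iff)
    show "distinct [u, v, z]"
      using uv w z part_verts by auto
    show "u \<in> M" "v \<in> M" "z \<in> M"
      using uv z by auto
  qed auto
  show False
  proof (cases "(y, z) \<in> parcs G")
    case True
    obtain w where "((x, w) \<in> parcs G) \<noteq> ((y, w) \<in> parcs G)"
      using ne by (auto simp: neighbours_def)
    with path4[of x y w] path4[of y x w] x y xz True show False
      by blast
  next
    case False
    have "monophonic_path H [x, y, z]"
      using verts dist xy xz False
      by (intro monophonic_path_3I symmetric_complement complement_loopfree) (auto simp: H_iff complement_verts)
    from mp_setD[OF M _ _ _ _ this, of x y z] x y z dist show False
      by auto
  qed
qed

lemma mp_set_not_uniform_imp_independent:
  assumes "mp_set H M" "\<not> uniform G (M \<inter> A)"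
  shows "independent_set G M"
proof -
  obtain x y where xy: "x \<in> M \<inter> A" "y \<in> M \<inter> A" "neighbours G x \<noteq> neighbours G y"
    using assms(2) by (auto simp: uniform_def)
  have no_edge: "(u, v) \<notin> parcs G" if "u \<in> M \<inter> A" "v \<in> M \<inter> B" for u v
  \<comment> \<open>At least one of \<open>x\<close>, \<open>y\<close> has a neighbourhood different
    from that of \<open>u\<close>, and it serves as the second vertex of \<open>A\<close>; this also
    covers \<open>u = x\<close> and \<open>u = y\<close>.\<close>
  proof (cases "neighbours G u = neighbours G x")
    case True
    with xy that mp_set_no_common_edge[OF assms(1), of u y v] show ?thesis by auto
  next
    case False
    with xy that mp_set_no_common_edge[OF assms(1), of u x v] show ?thesis by auto
  qed
  have "(u, v) \<notin> parcs G" if "u \<in> M" "v \<in> M" for u v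
  proof
    assume "(u, v) \<in> parcs G"
    moreover have "(v, u) \<in> parcs G"
      using calculation by (rule arcs_symmetric)
    ultimately show False
      using no_edge that bipartition by (auto simp: bipartition_def)
  qed
  moreover have "M \<subseteq> pverts G"
    using assms(1) by (simp add: mp_set_def complement_graph_def)
  ultimately show ?thesis
    by (auto simp: independent_set_def)
qed

lemma mp_set_complement_iff:
  "mp_set H M \<longleftrightarrow> independent_set G M \<or> uniform_set G A B M"
proof
  assume "mp_set H M"
  moreover from this have "M \<subseteq> pverts G"
    by (simp add: mp_set_def complement_graph_def)
  ultimately show "independent_set G M \<or> uniform_set G A B M"
    using mp_set_not_uniform_imp_independent
      bipartite_graph.mp_set_not_uniform_imp_independent[OF swap_parts]
    by (auto simp: uniform_set_def)
qed (blast intro: independent_set_imp_mp_set uniform_set_imp_mp_set)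

end

theorem theorem4p1:
  fixes G :: "'a pair_pre_digraph" and A B :: "'a set"
  assumes "pair_graph G"
    and "connected (with_proj G)"
    and "bipartition G A B"
  shows "mp_number (complement_graph G) =
    max (independence_number G) (uniform_number G A B)"
proof -
  have bip: "bipartite_graph G A B"
    using assms(1,3) by (rule bipartite_graph.intro)
  have finite_verts: "finite (pverts G)"
  proof -
    interpret pair_graph G by (rule assms(1))
    show ?thesis by (rule pair_finite_verts)
  qed
  have finite: "finite {card S | S. P S}" if "\<And>S. P S \<Longrightarrow> S \<subseteq> pverts G" for P
  proof -
    have "{card S | S. P S} \<subseteq> card ` Pow (pverts G)"
      using that by auto
    then show ?thesis
      by (rule finite_subset) (simp add: finite_verts)
  qed
  \<comment> \<open>The empty set makes both families of cardinalities nonempty, so that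
    \<open>Max_Un\<close> turns the maximum of their union into the larger of the two
    maxima.\<close>
  have "independent_set G {}" "uniform_set G A B {}"
    by (auto simp: independent_set_def uniform_set_def uniform_def)
  then have "{card S | S. independent_set G S} \<noteq> {}" "{card S | S. uniform_set G A B S} \<noteq> {}"
    by blast+
  moreover have "{card M | M. mp_set (complement_graph G) M} =
      {card S | S. independent_set G S} \<union> {card S | S. uniform_set G A B S}"
    by (auto simp: bipartite_graph.mp_set_complement_iff[OF bip])
  ultimately show ?thesis
    using finite[of "independent_set G"] finite[of "uniform_set G A B"]
    by (simp add: mp_number_def independence_number_def uniform_number_def Max_Un
        independent_set_def uniform_set_def)
qed

end
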